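(* Let $R$ be a real closed field and let $G$ be a reductive linear algebraic group over $R$. If $G$ has property $(\star)$, then $G(R)$ is semialgebraically compact.
   Context: Standing assumption: $G(R)$ is Zariski dense in $G$. $G$ reductive means that $G$ contains no non-trivial unipotent normal closed subgroup ($G$ is not required to be connected); equivalently every finite-dimensional $G$-module is a direct sum of irreducible ones. $G(R)$ is semialgebraically compact if it is closed and bounded in some affine space $R^N$. An affine $G$-variety is a reduced affine scheme $V$ of finite type over $R$ with a $G$-action given by a morphism $G\times V\to V$; $G(R)$ acts on the coordinate ring $R[V]$ by $f^g(x)=f(gx)$, with ring of invariants $R[V]^G$. The Reynolds operator $\rho_V\colon R[V]\to R[V]^G$ is the projection along the unique $G$-stable complement of $R[V]^G$ in $R[V]$. In particular $\rho_G\colon R[G]\to R$ is the Reynolds operator of $G$ acting on itself by (left) translation. Property $(\star)$ of $G$: the following two conditions, which are equivalent to each other, hold: (i) $\rho_G(f^2)\ge0$ for every $f\in R[G]$; (ii) for every affine $G$-variety $V$ one has $\rho_V(\Sigma R[V]^2)\subset\Sigma R[V]^2$, where $\Sigma R[V]^2$ is the set of finite sums of squares in $R[V]$. *)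

theory Defs
  imports "HOL-Analysis.Analysis" "HOL-Algebra.Algebraic_Closure_Type"
begin

(* Real closed fields: ordered fields in which nonnegative elements are squares and polynomials
   of odd degree have roots. The coefficient function c stands for a polynomial of degree n. *)
class real_closed_field = linordered_field +
  assumes nonneg_is_square: "0 \<le> a \<Longrightarrow> \<exists>b. b * b = a"
    and odd_degree_has_root: "odd n \<Longrightarrow> c n \<noteq> 0 \<Longrightarrow> \<exists>x. (\<Sum>i\<le>n. c i * x ^ i) = 0"

(* A variety over R is represented by its points over the algebraic closure K of R, its coordinate
   ring by K-valued functions on these points; to_ac is the embedding of R into K. *)

(* The R-algebra of functions generated by S. *)
inductive_set algebra_generated ::
    "('x \<Rightarrow> 'r::field alg_closure) set \<Rightarrow> ('x \<Rightarrow> 'r alg_closure) set"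
  for S :: "('x \<Rightarrow> 'r::field alg_closure) set" where
  const: "(\<lambda>_. to_ac c) \<in> algebra_generated S"
| gen: "f \<in> S \<Longrightarrow> f \<in> algebra_generated S"
| add: "f \<in> algebra_generated S \<Longrightarrow> g \<in> algebra_generated S
    \<Longrightarrow> (\<lambda>x. f x + g x) \<in> algebra_generated S"
| mult: "f \<in> algebra_generated S \<Longrightarrow> g \<in> algebra_generated S
    \<Longrightarrow> (\<lambda>x. f x * g x) \<in> algebra_generated S"

(* R[GL_n] is generated by the matrix entries and 1/det. (The values that such functions take at
   singular matrices are junk and never matter.) *)
definition GL_ring :: "('r::field alg_closure ^ 'n ^ 'n \<Rightarrow> 'r alg_closure) set" where
  "GL_ring = algebra_generated
     (insert (\<lambda>A. inverse (det A)) (range (\<lambda>(i, j) A. A $ i $ j)))"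

(* Elements of R[V] are functions on V; to have pointwise operations available they are
   extended by 0 outside V. *)
definition restrict0 :: "'x set \<Rightarrow> ('x \<Rightarrow> 'k::zero) \<Rightarrow> 'x \<Rightarrow> 'k" where
  "restrict0 V f = (\<lambda>x. if x \<in> V then f x else 0)"

definition coord_ring ::
    "('r::field alg_closure ^ 'n ^ 'n) set \<Rightarrow> ('r alg_closure ^ 'n ^ 'n \<Rightarrow> 'r alg_closure) set" where
  "coord_ring V = restrict0 V ` GL_ring"

(* Closed subsets of GL_n defined over R. *)
definition zariski_closed :: "('r::field alg_closure ^ 'n ^ 'n) set \<Rightarrow> bool" where
  "zariski_closed V \<longleftrightarrow> (\<exists>F\<subseteq>GL_ring. V = {A. invertible A \<and> (\<forall>f\<in>F. f A = 0)})"

definition linear_algebraic_group :: "('r::field alg_closure ^ 'n ^ 'n) set \<Rightarrow> bool" where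
  "linear_algebraic_group G \<longleftrightarrow> zariski_closed G \<and> mat 1 \<in> G \<and>
     (\<forall>A\<in>G. \<forall>B\<in>G. A ** B \<in> G) \<and> (\<forall>A\<in>G. matrix_inv A \<in> G)"

definition rational_points ::
    "('r::field alg_closure ^ 'n ^ 'n) set \<Rightarrow> ('r alg_closure ^ 'n ^ 'n) set" where
  "rational_points V = {A \<in> V. \<forall>i j. A $ i $ j \<in> range to_ac}"

definition zariski_dense_in ::
    "('r::field alg_closure ^ 'n ^ 'n) set \<Rightarrow> ('r alg_closure ^ 'n ^ 'n) set \<Rightarrow> bool" where
  "zariski_dense_in S V \<longleftrightarrow>
     S \<subseteq> V \<and> (\<forall>f\<in>coord_ring V. (\<forall>x\<in>S. f x = 0) \<longrightarrow> (\<forall>x\<in>V. f x = 0))"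

(* A - 1 is nilpotent. The operations * and ^ on the matrix type are entrywise, so powers are
   written as iterated products with **. *)
definition unipotent :: "'k::field ^ 'n ^ 'n \<Rightarrow> bool" where
  "unipotent A \<longleftrightarrow> (\<exists>m. ((\<lambda>B. (A - mat 1) ** B) ^^ m) (mat 1) = 0)"

definition reductive :: "('r::field alg_closure ^ 'n ^ 'n) set \<Rightarrow> bool" where
  "reductive G \<longleftrightarrow>
     (\<forall>N. linear_algebraic_group N \<and> N \<subseteq> G \<and>
          (\<forall>g\<in>G. \<forall>u\<in>N. g ** u ** matrix_inv g \<in> N) \<and>
          (\<forall>u\<in>N. unipotent u) \<longrightarrow> N = {mat 1})"

(* Let a group with set of R-points P act by act on a variety with coordinate ring A; elements of P
   act on A by (f^g)(x) = f (act g x). As R-points are assumed dense in the group, stability and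
   invariance under the group are the same as under P. *)
definition invariant_ring ::
    "'g set \<Rightarrow> ('g \<Rightarrow> 'x \<Rightarrow> 'x) \<Rightarrow> ('x \<Rightarrow> 'k) set \<Rightarrow> ('x \<Rightarrow> 'k) set" where
  "invariant_ring P act A = {f \<in> A. \<forall>g\<in>P. (\<lambda>x. f (act g x)) = f}"

definition stable_subspace ::
    "'g set \<Rightarrow> ('g \<Rightarrow> 'x \<Rightarrow> 'x) \<Rightarrow> ('x \<Rightarrow> 'r::field alg_closure) set \<Rightarrow> bool" where
  "stable_subspace P act W \<longleftrightarrow>
     (\<lambda>_. 0) \<in> W \<and>
     (\<forall>f\<in>W. \<forall>h\<in>W. (\<lambda>x. f x + h x) \<in> W) \<and>
     (\<forall>c. \<forall>f\<in>W. (\<lambda>x. to_ac c * f x) \<in> W) \<and>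
     (\<forall>g\<in>P. \<forall>f\<in>W. (\<lambda>x. f (act g x)) \<in> W)"

(* rho is the projection of A onto its invariants along a stable complement W. *)
definition is_reynolds_operator ::
    "'g set \<Rightarrow> ('g \<Rightarrow> 'x \<Rightarrow> 'x) \<Rightarrow> ('x \<Rightarrow> 'r::field alg_closure) set
      \<Rightarrow> (('x \<Rightarrow> 'r alg_closure) \<Rightarrow> 'x \<Rightarrow> 'r alg_closure) \<Rightarrow> bool" where
  "is_reynolds_operator P act A \<rho> \<longleftrightarrow>
     (\<exists>W\<subseteq>A. stable_subspace P act W \<and> W \<inter> invariant_ring P act A = {\<lambda>_. 0} \<and>
        (\<forall>f\<in>A. \<rho> f \<in> invariant_ring P act A \<and> (\<lambda>x. f x - \<rho> f x) \<in> W))"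

(* rho_G(f^2) \<ge> 0 for all f in R[G], where rho_G is the Reynolds operator of the left translation
   action of G on itself. Its values are constant functions on G, that is, elements of R. For
   reductive G there is exactly one Reynolds operator on R[G], so the existential quantifier just
   names it; if there were none the condition would count as false. This condition is equivalent to the
   Reynolds operators of all affine G-varieties preserving sums of squares. *)
definition property_star :: "('r::real_closed_field alg_closure ^ 'n ^ 'n) set \<Rightarrow> bool" where
  "property_star G \<longleftrightarrow>
     (\<exists>\<rho>. is_reynolds_operator (rational_points G) (\<lambda>g x. g ** x) (coord_ring G) \<rho> \<and>
        (\<forall>f\<in>coord_ring G. \<exists>c\<ge>0. \<rho> (\<lambda>x. f x * f x) = restrict0 G (\<lambda>_. to_ac c)))"

definition interval_topology :: "'r::linorder topology" where
  "interval_topology = topology_generated_by (range lessThan \<union> range greaterThan)"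

(* Points of affine space R^N are functions in {..<N} \<rightarrow>\<^sub>E UNIV. *)
definition semialgebraically_closed_bounded ::
    "nat \<Rightarrow> (nat \<Rightarrow> 'r::linordered_field) set \<Rightarrow> bool" where
  "semialgebraically_closed_bounded N S \<longleftrightarrow>
     closedin (product_topology (\<lambda>_. interval_topology) {..<N}) S \<and>
     (\<exists>B. \<forall>p\<in>S. \<forall>i<N. \<bar>p i\<bar> \<le> B)"

(* Functions f 0, ..., f (N - 1) generating R[V] are the same as a closed embedding of V into affine
   N-space over R; they take values in R at the R-points of V. *)
definition points_semialgebraically_compact ::
    "('r::linordered_field alg_closure ^ 'n ^ 'n) set \<Rightarrow> bool" where
  "points_semialgebraically_compact V \<longleftrightarrow>
     (\<exists>N f. coord_ring V = restrict0 V ` algebra_generated (f ` {..<N}) \<and>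
        semialgebraically_closed_bounded N
          {p \<in> {..<N} \<rightarrow>\<^sub>E UNIV. \<exists>x\<in>rational_points V. \<forall>i<N. to_ac (p i) = f i x})"

end

theory Submission
  imports Defs
begin

text \<open>
  Restricting the Reynolds operator \<open>\<rho>\<^sub>G\<close> to functions on \<open>P = G(R)\<close> gives a linear functional
  \<open>L\<close> on \<open>R[G]\<close> with values in \<open>R\<close> that is invariant under translation, satisfies \<open>L 1 = 1\<close> and, by property
  (\<open>\<star>\<close>), is nonnegative on squares (\<open>property_star_positive_invariant_mean\<close>). It plays the role of the
  integral over a compact group with respect to normalized Haar measure, and as in the unitarian trick it
  makes \<open>G(R)\<close> orthogonal: with \<open>x\<close> the matrix of coordinate functions on \<open>G\<close>, the bilinear form
  \<open>b(u, v) = \<Sum>\<^sub>j L((u x)\<^sub>j (v x)\<^sub>j)\<close> on row vectors is positive semidefinite and satisfies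
  \<open>b(u g, v g) = b(u, v)\<close> for \<open>g \<in> P\<close>.

  The form is even definite (\<open>form_definite\<close>). By the Cauchy-Schwarz inequality the functions \<open>f\<close> with
  \<open>L(f\<^sup>2) = 0\<close> form a translation invariant ideal of \<open>R[G]\<close>. Since a group has no proper nonempty
  invariant closed subset, such an ideal is zero or contains \<open>1\<close>, and the latter contradicts \<open>L 1 = 1\<close>. For the
  linear functions occurring in \<open>b\<close> this reduces to the identity \<open>v = (v x\<^sup>-\<^sup>1) x\<close>.

  So \<open>P\<close> preserves a positive definite form. The Cauchy-Schwarz inequality for \<open>b\<close> then bounds the entries
  of all \<open>g \<in> P\<close> (\<open>entry_bounded\<close>), and \<open>1/det g = det(g\<^sup>-\<^sup>1)\<close> is bounded as well. The entries and
  \<open>1/det\<close> generate \<open>R[G]\<close>, hence they embed \<open>P\<close> as a bounded subset of an affine space. This subset is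
  the zero set of polynomials, and polynomial maps are continuous in the interval topology of \<open>R\<close>, so it is
  also closed (\<open>real_points_closed\<close>).
\<close>

(* Otherwise indexing of formal power series competes with indexing of vectors. *)
no_notation fps_nth (infixl "$" 75)

section \<open>Boundedness of a matrix group with a positive invariant mean\<close>

lemma matrix_inv_inverse:
  assumes "invertible A"
  shows "A ** matrix_inv A = mat 1 \<and> matrix_inv A ** A = mat 1"
  using assms unfolding invertible_def matrix_inv_def by (rule someI_ex)

text \<open>At \<open>(s, t) = (c, - b)\<close> the quadratic form equals \<open>c * (a * c - b * b)\<close>, which settles the case \<open>c > 0\<close>.
  If \<open>c = 0\<close>, the form is affine in \<open>t\<close> for \<open>s = 1\<close> and stays nonnegative only if \<open>b = 0\<close>.\<close>

lemma nonneg_quadratic_form_discriminant: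
  fixes a b c :: "'a::linordered_field"
  assumes nonneg: "\<And>s t. 0 \<le> s * s * a + 2 * s * t * b + t * t * c"
  shows "b * b \<le> a * c"
proof -
  have "0 \<le> a" "0 \<le> c"
    using nonneg[of 1 0] nonneg[of 0 1] by simp_all
  show ?thesis
  proof (cases "c = 0")
    case True
    have "b = 0"
    proof (rule ccontr)
      assume "b \<noteq> 0"
      then show False
        using nonneg[of 1 "- (a + 1) / (2 * b)"] True by (simp add: field_simps)
    qed
    then show ?thesis
      using True by simp
  next
    case False
    then have "0 < c"
      using \<open>0 \<le> c\<close> by simp
    have "c * c * a + 2 * c * (- b) * b + (- b) * (- b) * c = c * (a * c - b * b)"
      by (simp add: algebra_simps)
    then have "0 \<le> c * (a * c - b * b)"
      using nonneg[of c "- b"] by simp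
    then show ?thesis
      using \<open>0 < c\<close> by (simp add: zero_le_mult_iff)
  qed
qed

text \<open>The situation that the Reynolds operator creates on the real points \<open>P\<close> of \<open>G\<close>, with \<open>A\<close> in the
  role of \<open>R[G]\<close>. The elements of \<open>A\<close> are functions on all matrices, but \<open>mean_cong\<close> lets \<open>L\<close> depend only
  on their values on \<open>P\<close>. The entries of the inverse belong to \<open>A\<close> because \<open>1/det\<close> is regular on
  \<open>GL\<^sub>n\<close>.\<close>

locale positive_invariant_mean =
  fixes P :: "('r::linordered_field ^ 'n ^ 'n) set"
    and A :: "('r ^ 'n ^ 'n \<Rightarrow> 'r) set"
    and L :: "('r ^ 'n ^ 'n \<Rightarrow> 'r) \<Rightarrow> 'r"
  assumes group_mult: "x \<in> P \<Longrightarrow> y \<in> P \<Longrightarrow> x ** y \<in> P"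
    and group_inverse: "x \<in> P \<Longrightarrow> invertible x \<and> matrix_inv x \<in> P"
    and const_mem: "(\<lambda>_. c) \<in> A"
    and entry_mem: "(\<lambda>x. x $ i $ j) \<in> A"
    and inverse_entry_mem: "(\<lambda>x. matrix_inv x $ i $ j) \<in> A"
    and add_mem: "f \<in> A \<Longrightarrow> h \<in> A \<Longrightarrow> (\<lambda>x. f x + h x) \<in> A"
    and mult_mem: "f \<in> A \<Longrightarrow> h \<in> A \<Longrightarrow> (\<lambda>x. f x * h x) \<in> A"
    and mean_cong: "f \<in> A \<Longrightarrow> h \<in> A \<Longrightarrow> (\<And>x. x \<in> P \<Longrightarrow> f x = h x) \<Longrightarrow> L f = L h"
    and mean_add: "f \<in> A \<Longrightarrow> h \<in> A \<Longrightarrow> L (\<lambda>x. f x + h x) = L f + L h"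
    and mean_scale: "f \<in> A \<Longrightarrow> L (\<lambda>x. c * f x) = c * L f"
    and mean_one: "L (\<lambda>_. 1) = 1"
    and mean_translate: "g \<in> P \<Longrightarrow> f \<in> A \<Longrightarrow> L (\<lambda>x. f (g ** x)) = L f"
    and mean_square: "f \<in> A \<Longrightarrow> 0 \<le> L (\<lambda>x. f x * f x)"
begin

lemma mean_zero: "L (\<lambda>_. 0) = 0"
  using mean_scale[of "\<lambda>_. 0" 0] const_mem by simp

lemma scale_mem: "f \<in> A \<Longrightarrow> (\<lambda>x. c * f x) \<in> A"
  using mult_mem[OF const_mem] .

lemma sum_mem: "(\<And>i. i \<in> I \<Longrightarrow> f i \<in> A) \<Longrightarrow> (\<lambda>x. \<Sum>i\<in>I. f i x) \<in> A"
  by (induction I rule: infinite_finite_induct) (auto intro: const_mem add_mem)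

lemma mean_sum: "(\<And>i. i \<in> I \<Longrightarrow> f i \<in> A) \<Longrightarrow> L (\<lambda>x. \<Sum>i\<in>I. f i x) = (\<Sum>i\<in>I. L (f i))"
proof (induction I rule: infinite_finite_induct)
  case (insert i I)
  then show ?case
    using mean_add[of "f i" "\<lambda>x. \<Sum>i\<in>I. f i x"] sum_mem[of I f] by simp
qed (simp_all add: mean_zero)

lemma row_combination_mem: "(\<lambda>x. (u v* x) $ j) \<in> A"
  unfolding vector_matrix_mult_def vec_lambda_beta
  by (intro sum_mem scale_mem entry_mem)

lemma mean_cauchy_schwarz:
  assumes f: "f \<in> A" and h: "h \<in> A"
  shows "L (\<lambda>x. f x * h x) * L (\<lambda>x. f x * h x) \<le> L (\<lambda>x. f x * f x) * L (\<lambda>x. h x * h x)"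
proof (rule nonneg_quadratic_form_discriminant)
  fix s t
  have ff: "(\<lambda>x. f x * f x) \<in> A" and fh: "(\<lambda>x. f x * h x) \<in> A" and hh: "(\<lambda>x. h x * h x) \<in> A"
    by (intro mult_mem f h)+
  have "(\<lambda>x. s * f x + t * h x) \<in> A"
    by (intro add_mem scale_mem f h)
  then have "0 \<le> L (\<lambda>x. (s * f x + t * h x) * (s * f x + t * h x))"
    by (rule mean_square)
  also have "(\<lambda>x. (s * f x + t * h x) * (s * f x + t * h x)) =
      (\<lambda>x. (s * s * (f x * f x) + 2 * s * t * (f x * h x)) + t * t * (h x * h x))"
    by (simp add: algebra_simps fun_eq_iff)
  also have "L \<dots> = s * s * L (\<lambda>x. f x * f x) + 2 * s * t * L (\<lambda>x. f x * h x)
      + t * t * L (\<lambda>x. h x * h x)"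
    by (simp only: mean_add mean_scale add_mem scale_mem ff fh hh)
  finally show "0 \<le> \<dots>" .
qed

text \<open>If \<open>x\<close> denotes the matrix of coordinate functions, then \<open>u v* x\<close> is a row of regular functions and
  translating it by \<open>g\<close> gives \<open>(u v* g) v* x\<close>. So the \<open>L\<close>-inner product of such rows is a form on
  vectors that the group preserves.\<close>

definition form :: "'r ^ 'n \<Rightarrow> 'r ^ 'n \<Rightarrow> 'r" where
  "form u v = (\<Sum>j\<in>UNIV. L (\<lambda>x. (u v* x) $ j * (v v* x) $ j))"

lemma form_add_left: "form (u + v) w = form u w + form v w"
  unfolding form_def vector_matrix_left_distrib vector_add_component distrib_right
  by (subst mean_add) (simp_all add: mult_mem row_combination_mem sum.distrib)

lemma form_scale_left: "form (c *s u) w = c * form u w"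
  unfolding form_def scalar_vector_matrix_assoc vector_smult_component mult.assoc
  by (subst mean_scale) (simp_all add: mult_mem row_combination_mem sum_distrib_left)

lemma form_commute: "form u v = form v u"
  unfolding form_def by (simp add: mult.commute)

lemma form_add_right: "form w (u + v) = form w u + form w v"
  using form_add_left by (simp add: form_commute[of w])

lemma form_scale_right: "form w (c *s u) = c * form w u"
  using form_scale_left by (simp add: form_commute[of w])

lemma form_nonneg: "0 \<le> form u u"
  unfolding form_def by (intro sum_nonneg mean_square row_combination_mem)

lemma form_cauchy_schwarz: "form u v * form u v \<le> form u u * form v v"
proof (rule nonneg_quadratic_form_discriminant)
  fix s t
  show "0 \<le> s * s * form u u + 2 * s * t * form u v + t * t * form v v"
    using form_nonneg[of "s *s u + t *s v"] form_commute[of u v]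
    by (simp add: form_add_left form_add_right form_scale_left form_scale_right algebra_simps)
qed

lemma form_translate:
  assumes "g \<in> P"
  shows "form (u v* g) (v v* g) = form u v"
  unfolding form_def
proof (rule sum.cong[OF refl])
  fix j
  show "L (\<lambda>x. (u v* g v* x) $ j * (v v* g v* x) $ j) = L (\<lambda>x. (u v* x) $ j * (v v* x) $ j)"
    using mean_translate[OF assms, of "\<lambda>x. (u v* x) $ j * (v v* x) $ j"]
    by (simp add: vector_matrix_mul_assoc mult_mem row_combination_mem)
qed

text \<open>The terms of the sum \<open>form u u\<close> are nonnegative, so each of them is zero. By the Cauchy-Schwarz
  inequality a function whose square has mean zero is orthogonal to all of \<open>A\<close>.\<close>

lemma isotropic_mean_zero:
  assumes "form u u = 0" and f: "f \<in> A"
  shows "L (\<lambda>x. f x * (u v* x) $ j) = 0"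
proof -
  have "\<forall>j\<in>UNIV. L (\<lambda>x. (u v* x) $ j * (u v* x) $ j) = 0"
    using assms(1) unfolding form_def
    by (subst (asm) sum_nonneg_eq_0_iff) (auto intro: mean_square row_combination_mem)
  then have "L (\<lambda>x. f x * (u v* x) $ j) * L (\<lambda>x. f x * (u v* x) $ j) \<le> 0"
    using mean_cauchy_schwarz[OF f row_combination_mem[of u j]] by simp
  then show ?thesis
    by (auto simp: mult_le_0_iff)
qed

lemma form_isotropic_subspace: "vec.subspace {u. form u u = 0}"
proof -
  have zero: "form u w = 0" if "form u u = 0" for u w
    using form_cauchy_schwarz[of u w] that
    by (auto simp: mult_le_0_iff)
  have "form 0 0 = 0"
    unfolding form_def by (simp add: mean_zero)
  then show ?thesis
    using zero
    by (auto simp: vec.subspace_def form_add_left form_add_right form_scale_left form_scale_right)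
qed

text \<open>The vectors \<open>u\<close> with \<open>form u u = 0\<close> form a subspace \<open>U\<close> that the group preserves. Let \<open>T\<close> be the
  matrix of a linear projection onto \<open>U\<close> (acting on rows from the right). For \<open>v \<in> U\<close> and \<open>x\<close> in the
  group also \<open>v x\<^sup>-\<^sup>1 \<in> U\<close>, hence \<open>v = v x\<^sup>-\<^sup>1 T x\<close>. This writes each constant \<open>v\<^sub>j\<close> as a
  combination, with coefficients \<open>(v x\<^sup>-\<^sup>1)\<^sub>k\<close> in \<open>A\<close>, of entries of the rows \<open>T\<^sub>k x\<close> with
  \<open>T\<^sub>k \<in> U\<close>, which are orthogonal to \<open>A\<close>. So the constant \<open>v\<^sub>j\<close> has mean zero, and \<open>L 1 = 1\<close> yields
  \<open>v\<^sub>j = 0\<close>. In geometric terms: a nonzero translation invariant ideal of \<open>R[G]\<close> contains \<open>1\<close>, and the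
  formula produces it explicitly.\<close>

lemma form_definite:
  assumes "form v v = 0"
  shows "v = 0"
proof -
  let ?U = "{u. form u u = 0}"
  obtain p where "range p \<subseteq> ?U" and p_linear: "Vector_Spaces.linear (*s) (*s) p"
    and p_id: "\<And>u. u \<in> ?U \<Longrightarrow> p u = u"
    using vec.linear_exists_left_inverse_on[OF vec.linear_id form_isotropic_subspace inj_on_id]
    by auto
  define T where "T = transpose (matrix p)"
  have T: "u v* T = p u" for u
    unfolding T_def by (simp add: matrix_works p_linear)
  have rows: "form (T $ k) (T $ k) = 0" for k
  proof -
    have "T $ k = axis k 1 v* T"
      by (simp add: vec_eq_iff vector_matrix_mult_def axis_def if_distrib if_distribR cong: if_cong)
    then show ?thesis
      using T[of "axis k 1"] \<open>range p \<subseteq> ?U\<close> by auto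
  qed
  (* The coefficients depend on x, so they have to be regular functions of x. *)
  have y_mem: "(\<lambda>x. (v v* matrix_inv x) $ k) \<in> A" for k
    unfolding vector_matrix_mult_def vec_lambda_beta
    by (intro sum_mem scale_mem inverse_entry_mem)
  have "v $ j = 0" for j
  proof -
    have "v $ j = (\<Sum>k\<in>UNIV. (v v* matrix_inv x) $ k * (T $ k v* x) $ j)" if x: "x \<in> P" for x
    proof -
      have inv: "matrix_inv x ** x = mat 1"
        using matrix_inv_inverse group_inverse[OF x] by blast
      have "v v* matrix_inv x \<in> ?U"
        using form_translate[of "matrix_inv x" v v] group_inverse[OF x] assms by simp
      then have "v v* matrix_inv x = v v* matrix_inv x v* T"
        by (simp add: T p_id)
      then have "v = v v* matrix_inv x v* (T ** x)"
        using inv by (metis vector_matrix_mul_assoc vector_matrix_mul_rid)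
      then have "v $ j = (v v* matrix_inv x v* (T ** x)) $ j"
        by (rule arg_cong)
      also have "\<dots> = (\<Sum>k\<in>UNIV. (v v* matrix_inv x) $ k * (T $ k v* x) $ j)"
        by (simp add: vector_matrix_mult_def matrix_matrix_mult_def)
      finally show ?thesis .
    qed
    then have "L (\<lambda>_. v $ j) = L (\<lambda>x. \<Sum>k\<in>UNIV. (v v* matrix_inv x) $ k * (T $ k v* x) $ j)"
      by (intro mean_cong const_mem sum_mem mult_mem y_mem row_combination_mem)
    also have "\<dots> = (\<Sum>k\<in>UNIV. L (\<lambda>x. (v v* matrix_inv x) $ k * (T $ k v* x) $ j))"
      by (intro mean_sum mult_mem y_mem row_combination_mem)
    also have "\<dots> = 0"
      by (simp add: isotropic_mean_zero rows y_mem)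
    finally show ?thesis
      using mean_scale[OF const_mem, of "v $ j" 1] by (simp add: mean_one)
  qed
  then show ?thesis
    by (simp add: vec_eq_iff)
qed

text \<open>A definite form on a finite-dimensional space identifies it with its dual; \<open>w\<close> represents the
  \<open>k\<close>-th coordinate.\<close>

lemma form_dual_vector: "\<exists>w. \<forall>v. form w v = v $ k"
proof -
  let ?D = "\<lambda>w. \<chi> i. form w (axis i 1)"
  have expand: "form w v = (\<Sum>i\<in>UNIV. v $ i * ?D w $ i)" for w v
  proof -
    have zero: "form w 0 = 0"
      using form_scale_right[of w 0 0] by simp
    have "form w (\<Sum>i\<in>I. v $ i *s axis i 1) = (\<Sum>i\<in>I. v $ i * form w (axis i 1))" for I
      by (induction I rule: infinite_finite_induct)
        (simp_all add: zero form_add_right form_scale_right)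
    from this[of UNIV] show ?thesis
      by (simp add: basis_expansion)
  qed
  have linear: "Vector_Spaces.linear (*s) (*s) ?D"
    by unfold_locales (simp_all add: vec_eq_iff form_add_left form_scale_left algebra_simps)
  have "inj ?D"
  proof (subst vec.linear_inj_iff_eq_0[OF linear], intro allI impI)
    fix w
    assume "?D w = 0"
    then have "form w w = 0"
      by (simp add: expand[of w w] vec_eq_iff)
    then show "w = 0"
      by (rule form_definite)
  qed
  then have "surj ?D"
    by (rule vec.linear_inj_imp_surj[OF linear])
  then obtain w where w: "?D w = axis k 1"
    using surjD[of ?D "axis k 1"] by auto
  have "form w v = v $ k" for v
    unfolding expand[of w v] w by (simp add: axis_def if_distrib cong: if_cong)
  then show ?thesis
    by blast
qed

text \<open>All rows \<open>e\<^sub>i g\<close> have the same length as \<open>e\<^sub>i\<close>, and the Cauchy-Schwarz inequality against the dual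
  vector of a coordinate turns this into a bound on that coordinate. Over an arbitrary ordered field this
  replaces the comparison with the minimum of the form on the unit sphere, which might not exist.\<close>

lemma entry_bounded: "\<exists>B. \<forall>g\<in>P. \<bar>g $ i $ k\<bar> \<le> B"
proof -
  obtain w where w: "\<And>v. form w v = v $ k"
    using form_dual_vector[of k] by blast
  define B where "B = form w w * form (axis i 1) (axis i 1)"
  (* The square of the entry is at most B, and 2 |t| \<le> 1 + t * t for every t. *)
  have "\<bar>g $ i $ k\<bar> \<le> 1 + B" if "g \<in> P" for g
  proof -
    have row: "(axis i 1 v* g) $ k = g $ i $ k"
      by (simp add: vector_matrix_mult_def axis_def if_distrib if_distribR cong: if_cong)
    have "g $ i $ k * g $ i $ k \<le> form w w * form (axis i 1 v* g) (axis i 1 v* g)"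
      using form_cauchy_schwarz[of w "axis i 1 v* g"] by (simp add: w row)
    then have "\<bar>g $ i $ k\<bar> * \<bar>g $ i $ k\<bar> \<le> B"
      unfolding B_def by (simp add: form_translate[OF that])
    moreover have "0 \<le> (\<bar>g $ i $ k\<bar> - 1) * (\<bar>g $ i $ k\<bar> - 1)"
      by simp
    moreover have "0 \<le> \<bar>g $ i $ k\<bar> * \<bar>g $ i $ k\<bar>"
      by simp
    ultimately show ?thesis
      by (simp add: algebra_simps)
  qed
  then show ?thesis
    by blast
qed

lemma entries_bounded: "\<exists>B. \<forall>g\<in>P. \<forall>i k. \<bar>g $ i $ k\<bar> \<le> B"
proof -
  obtain b where b: "\<And>i k g. g \<in> P \<Longrightarrow> \<bar>g $ i $ k\<bar> \<le> b i k"
    using entry_bounded by metis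
  have "\<bar>g $ i $ k\<bar> \<le> Max (range (\<lambda>(i, k). b i k))" if "g \<in> P" for g i k
  proof -
    have "b i k \<le> Max (range (\<lambda>(i, k). b i k))"
      by (rule Max_ge) (auto intro: rev_image_eqI[of "(i, k)"])
    then show ?thesis
      using b[OF that, of i k] by linarith
  qed
  then show ?thesis
    by blast
qed

text \<open>The number \<open>1/det g\<close> is the determinant of \<open>g\<^sup>-\<^sup>1\<close>, another element of the group, and so a
  polynomial in bounded entries.\<close>

lemma inverse_det_bounded: "\<exists>B. \<forall>g\<in>P. \<bar>inverse (det g)\<bar> \<le> B"
proof -
  obtain B where B: "\<And>g i k. g \<in> P \<Longrightarrow> \<bar>g $ i $ k\<bar> \<le> B"
    using entries_bounded by blast
  have "\<bar>inverse (det g)\<bar> \<le> (\<Sum>p | p permutes (UNIV :: 'n set). \<Prod>i\<in>(UNIV :: 'n set). B)"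
    if g: "g \<in> P" for g
  proof -
    have "matrix_inv g ** g = mat 1"
      using matrix_inv_inverse group_inverse[OF g] by blast
    then have "det (matrix_inv g) * det g = 1"
      by (metis det_mul det_I)
    then have "inverse (det g) = det (matrix_inv g)"
      by (metis inverse_unique mult.commute)
    also have "\<bar>\<dots>\<bar> \<le> (\<Sum>p | p permutes (UNIV :: 'n set).
        \<bar>of_int (sign p) * (\<Prod>i\<in>UNIV. matrix_inv g $ i $ p i)\<bar>)"
      unfolding det_def by (rule sum_abs)
    also have "\<dots> \<le> (\<Sum>p | p permutes (UNIV :: 'n set). \<Prod>i\<in>(UNIV :: 'n set). B)"
    proof (rule sum_mono)
      fix p :: "'n \<Rightarrow> 'n"
      have "\<bar>of_int (sign p) :: 'r\<bar> = 1"
        by (simp add: sign_def)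
      then show "\<bar>of_int (sign p) * (\<Prod>i\<in>UNIV. matrix_inv g $ i $ p i)\<bar> \<le> (\<Prod>i\<in>(UNIV :: 'n set). B)"
        unfolding abs_mult abs_prod
        using B group_inverse[OF g] by (simp only: mult_1) (intro prod_mono, simp)
    qed
    finally show ?thesis .
  qed
  then show ?thesis
    by blast
qed

end

section \<open>Continuity of polynomial maps in the interval topology\<close>

lemma topspace_interval_topology [simp]:
  "topspace (interval_topology :: 'r::linordered_field topology) = UNIV"
  unfolding interval_topology_def topology_generated_by_topspace using lt_ex by auto

lemma continuous_map_interval_topology_iff:
  "continuous_map T interval_topology f \<longleftrightarrow>
     (\<forall>a. openin T {x \<in> topspace T. f x < a} \<and> openin T {x \<in> topspace T. a < (f x :: 'r::linordered_field)})"
proof -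
  have "f ` topspace T \<subseteq> \<Union> (range lessThan \<union> range greaterThan)"
    using lt_ex by auto
  moreover have "f -` lessThan a \<inter> topspace T = {x \<in> topspace T. f x < a}"
      "f -` greaterThan a \<inter> topspace T = {x \<in> topspace T. a < f x}" for a
    by auto
  ultimately show ?thesis
    unfolding interval_topology_def continuous_on_generated_topo_iff Un_iff
    by (metis (no_types, lifting) imageE rangeI)
qed

lemma continuous_map_interval_const:
  "continuous_map T interval_topology (\<lambda>_. c :: 'r::linordered_field)"
  by simp

lemma continuous_map_interval_add:
  fixes f g :: "'a \<Rightarrow> 'r::linordered_field"
  assumes f: "continuous_map T interval_topology f" and g: "continuous_map T interval_topology g"
  shows "continuous_map T interval_topology (\<lambda>x. f x + g x)"
proof -
  have less: "u + v < a \<longleftrightarrow> (\<exists>b. u < b \<and> v < a - b)" for a u v :: 'r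
  proof
    assume "u + v < a"
    then show "\<exists>b. u < b \<and> v < a - b"
      by (intro exI[of _ "u + (a - u - v) / 2"]) (simp add: field_simps)
  next
    assume "\<exists>b. u < b \<and> v < a - b"
    then obtain b where "u < b" "v < a - b"
      by blast
    then show "u + v < a"
      by linarith
  qed
  have greater: "a < u + v \<longleftrightarrow> (\<exists>b. b < u \<and> a - b < v)" for a u v :: 'r
  proof
    assume "a < u + v"
    then show "\<exists>b. b < u \<and> a - b < v"
      by (intro exI[of _ "u - (u + v - a) / 2"]) (simp add: field_simps)
  next
    assume "\<exists>b. b < u \<and> a - b < v"
    then obtain b where "b < u" "a - b < v"
      by blast
    then show "a < u + v"
      by linarith
  qed
  have "{x \<in> topspace T. f x + g x < a} =
      (\<Union>b. {x \<in> topspace T. f x < b} \<inter> {x \<in> topspace T. g x < a - b})" for a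
    by (auto simp: less)
  moreover have "{x \<in> topspace T. a < f x + g x} =
      (\<Union>b. {x \<in> topspace T. b < f x} \<inter> {x \<in> topspace T. a - b < g x})" for a
    by (auto simp: greater)
  ultimately show ?thesis
    using f g by (auto simp: continuous_map_interval_topology_iff intro!: openin_Union)
qed

lemma continuous_map_interval_minus:
  fixes f :: "'a \<Rightarrow> 'r::linordered_field"
  assumes "continuous_map T interval_topology f"
  shows "continuous_map T interval_topology (\<lambda>x. - f x)"
proof -
  have "{x \<in> topspace T. - f x < a} = {x \<in> topspace T. - a < f x}"
      "{x \<in> topspace T. a < - f x} = {x \<in> topspace T. f x < - a}" for a
    by auto
  then show ?thesis
    using assms by (simp add: continuous_map_interval_topology_iff)
qed

text \<open>For \<open>a = s * s\<close> with \<open>s \<ge> 0\<close>, the condition \<open>f x * f x < a\<close> means \<open>- s < f x < s\<close>. This is where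
  square roots in real closed fields are used; products then follow by polarization.\<close>

lemma continuous_map_interval_square:
  fixes f :: "'a \<Rightarrow> 'r::real_closed_field"
  assumes "continuous_map T interval_topology f"
  shows "continuous_map T interval_topology (\<lambda>x. f x * f x)"
  unfolding continuous_map_interval_topology_iff
proof
  fix a :: 'r
  have f: "openin T {x \<in> topspace T. f x < b}" "openin T {x \<in> topspace T. b < f x}" for b
    using assms by (auto simp: continuous_map_interval_topology_iff)
  show "openin T {x \<in> topspace T. f x * f x < a} \<and> openin T {x \<in> topspace T. a < f x * f x}"
  proof (cases "0 \<le> a")
    case True
    then obtain s where s: "0 \<le> s" "s * s = a"
      using nonneg_is_square[OF True] by (metis abs_ge_zero abs_mult_self_eq)
    have "a \<le> u * u \<longleftrightarrow> s \<le> \<bar>u\<bar>" "u * u \<le> a \<longleftrightarrow> \<bar>u\<bar> \<le> s" for u :: 'r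
      using s abs_le_square_iff[of s u] abs_le_square_iff[of u s] by (simp_all add: power2_eq_square)
    then have square_less: "u * u < a \<longleftrightarrow> \<bar>u\<bar> < s" and less_square: "a < u * u \<longleftrightarrow> s < \<bar>u\<bar>"
      for u :: 'r
      by (simp_all only: not_le [symmetric])
    have "{x \<in> topspace T. f x * f x < a} =
        {x \<in> topspace T. - s < f x} \<inter> {x \<in> topspace T. f x < s}"
      unfolding square_less abs_less_iff by auto
    moreover have "{x \<in> topspace T. a < f x * f x} =
        {x \<in> topspace T. f x < - s} \<union> {x \<in> topspace T. s < f x}"
      unfolding less_square by (auto simp: abs_if)
    ultimately show ?thesis
      using f by (simp add: openin_Int openin_Un)
  next
    case False
    then have "\<not> u * u < a" "a < u * u" for u :: 'r
      using zero_le_square[of u] by linarith+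
    then show ?thesis
      by simp
  qed
qed

lemma continuous_map_interval_mult:
  fixes f g :: "'a \<Rightarrow> 'r::real_closed_field"
  assumes "continuous_map T interval_topology f" and "continuous_map T interval_topology g"
  shows "continuous_map T interval_topology (\<lambda>x. f x * g x)"
proof -
  have halve: "continuous_map T interval_topology (\<lambda>x. h x / 2)"
    if "continuous_map T interval_topology h" for h :: "'a \<Rightarrow> 'r"
  proof -
    have "h x / 2 < a \<longleftrightarrow> h x < 2 * a" "a < h x / 2 \<longleftrightarrow> 2 * a < h x" for x a
      by (auto simp: field_simps)
    then show ?thesis
      using that by (simp add: continuous_map_interval_topology_iff)
  qed
  have "f x * g x = ((f x + g x) * (f x + g x) + - (f x * f x + g x * g x)) / 2" for x
    by (simp add: algebra_simps)
  then show ?thesis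
    by (simp only:)
      (intro halve continuous_map_interval_add continuous_map_interval_minus
        continuous_map_interval_square assms)
qed

lemma closedin_zero_set:
  fixes f :: "'a \<Rightarrow> 'r::linordered_field"
  assumes "continuous_map T interval_topology f"
  shows "closedin T {x \<in> topspace T. f x = 0}"
proof -
  have "topspace T - {x \<in> topspace T. f x = 0} = {x \<in> topspace T. f x < 0} \<union> {x \<in> topspace T. 0 < f x}"
    by auto
  then show ?thesis
    using assms by (auto simp: closedin_def continuous_map_interval_topology_iff)
qed

lemma continuous_map_interval_det:
  fixes M :: "'a \<Rightarrow> 'r::real_closed_field ^ 'n ^ 'n"
  assumes "\<And>i j. continuous_map T interval_topology (\<lambda>x. M x $ i $ j)"
  shows "continuous_map T interval_topology (\<lambda>x. det (M x))"
proof -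
  have prod: "continuous_map T interval_topology (\<lambda>x. \<Prod>i\<in>I. f i x)"
    if "\<And>i. continuous_map T interval_topology (f i)" for I and f :: "'n \<Rightarrow> 'a \<Rightarrow> 'r"
    by (induction I rule: infinite_finite_induct)
      (simp_all add: that continuous_map_interval_const continuous_map_interval_mult)
  have sum: "continuous_map T interval_topology (\<lambda>x. \<Sum>i\<in>I. f i x)"
    if "\<And>i. continuous_map T interval_topology (f i)" for I and f :: "('n \<Rightarrow> 'n) \<Rightarrow> 'a \<Rightarrow> 'r"
    by (induction I rule: infinite_finite_induct)
      (simp_all add: that continuous_map_interval_const continuous_map_interval_add)
  show ?thesis
    unfolding det_def
    by (intro sum prod continuous_map_interval_mult continuous_map_interval_const assms)
qed

section \<open>Regular functions and real points\<close>

lemma algebra_generated_sum: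
  assumes "\<And>i. i \<in> I \<Longrightarrow> f i \<in> algebra_generated S"
  shows "(\<lambda>x. \<Sum>i\<in>I. f i x) \<in> algebra_generated S"
  using assms
  by (induction I rule: infinite_finite_induct)
    (auto intro: algebra_generated.add simp: algebra_generated.const[of 0, simplified])

lemma algebra_generated_prod:
  assumes "\<And>i. i \<in> I \<Longrightarrow> f i \<in> algebra_generated S"
  shows "(\<lambda>x. \<Prod>i\<in>I. f i x) \<in> algebra_generated S"
  using assms
  by (induction I rule: infinite_finite_induct)
    (auto intro: algebra_generated.mult simp: algebra_generated.const[of 1, simplified])

lemma algebra_generated_det:
  fixes M :: "'x \<Rightarrow> 'r::field alg_closure ^ 'n ^ 'n"
  assumes "\<And>i j. (\<lambda>x. M x $ i $ j) \<in> algebra_generated S"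
  shows "(\<lambda>x. det (M x)) \<in> algebra_generated S"
proof -
  have "(\<lambda>_. of_int k) \<in> algebra_generated S" for k
    using algebra_generated.const[of "of_int k" S] by simp
  then show ?thesis
    unfolding det_def
    by (intro algebra_generated_sum algebra_generated_prod algebra_generated.mult assms)
qed

lemma det_map_matrix_to_ac: "det (map_matrix to_ac h) = to_ac (det h)"
  by (simp add: det_def to_ac_sum to_ac_prod)

lemma invertible_map_matrix_to_ac:
  fixes h :: "'r::field ^ 'n ^ 'n"
  shows "invertible (map_matrix to_ac h) \<longleftrightarrow> invertible h"
  by (simp add: invertible_det_nz det_map_matrix_to_ac)

lemma map_matrix_to_ac_mult: "map_matrix to_ac (g ** h) = map_matrix to_ac g ** map_matrix to_ac h"
  by (simp add: vec_eq_iff matrix_matrix_mult_def to_ac_sum)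

lemma map_matrix_to_ac_inv:
  fixes h :: "'r::field ^ 'n ^ 'n"
  assumes "invertible h"
  shows "map_matrix to_ac (matrix_inv h) = matrix_inv (map_matrix to_ac h)"
proof -
  let ?M = "map_matrix to_ac h" and ?I = "map_matrix to_ac (matrix_inv h)"
  have "map_matrix to_ac (mat 1 :: 'r ^ 'n ^ 'n) = mat 1"
    by (simp add: vec_eq_iff mat_def)
  then have "?I ** ?M = mat 1"
    using matrix_inv_inverse[OF assms] by (metis map_matrix_to_ac_mult)
  moreover have "?M ** matrix_inv ?M = mat 1"
    using matrix_inv_inverse[of ?M] assms by (simp add: invertible_map_matrix_to_ac)
  ultimately show ?thesis
    by (metis matrix_mul_assoc matrix_mul_lid matrix_mul_rid)
qed

text \<open>Cramer's rule for \<open>A y = e\<^sub>j\<close>: it exhibits the entries of the inverse as polynomials in the entries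
  times \<open>1/det\<close>.\<close>

lemma matrix_inv_entry_cramer:
  fixes A :: "'a::field ^ 'n ^ 'n"
  assumes "invertible A"
  shows "matrix_inv A $ k $ j =
    det (\<chi> i l. if l = k then axis j 1 $ i else A $ i $ l) * inverse (det A)"
proof -
  have "A *v (matrix_inv A *v axis j 1) = axis j 1"
    using matrix_inv_inverse[OF assms] by (simp add: matrix_vector_mul_assoc)
  then have "matrix_inv A *v axis j 1 =
      (\<chi> k. det (\<chi> i l. if l = k then axis j 1 $ i else A $ i $ l) / det A)"
    using assms by (simp add: cramer invertible_det_nz)
  moreover have "(matrix_inv A *v axis j 1) $ k = matrix_inv A $ k $ j"
    by (simp add: matrix_vector_mult_def axis_def if_distrib cong: if_cong)
  ultimately show ?thesis
    by (simp add: divide_inverse)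
qed

lemma GL_ring_entry: "(\<lambda>x. x $ i $ j) \<in> GL_ring"
  unfolding GL_ring_def
  by (rule algebra_generated.gen) (auto intro: rev_image_eqI[of "(i, j)"])

lemma GL_ring_inverse_entry:
  "\<exists>F\<in>GL_ring :: ('r::field alg_closure ^ 'n ^ 'n \<Rightarrow> 'r alg_closure) set.
    \<forall>x. invertible x \<longrightarrow> F x = matrix_inv x $ k $ j"
proof -
  have "(\<lambda>x :: 'r alg_closure ^ 'n ^ 'n. det (\<chi> i l. if l = k then axis j 1 $ i else x $ i $ l)) \<in> GL_ring"
    unfolding GL_ring_def
  proof (rule algebra_generated_det)
    fix i l
    let ?S = "insert (\<lambda>A. inverse (det A)) (range (\<lambda>(i :: 'n, j :: 'n) A :: 'r alg_closure ^ 'n ^ 'n. A $ i $ j))"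
    have "(\<lambda>x. x $ i $ l) \<in> algebra_generated ?S"
      using GL_ring_entry[of i l] by (simp add: GL_ring_def)
    moreover have "(\<lambda>_. axis j 1 $ i) \<in> algebra_generated ?S"
      using algebra_generated.const[of "axis j 1 $ i" ?S] by (cases "i = j") (simp_all add: axis_def)
    ultimately show "(\<lambda>x. (\<chi> i l. if l = k then axis j 1 $ i else x $ i $ l) $ i $ l)
        \<in> algebra_generated ?S"
      by (cases "l = k") simp_all
  qed
  moreover have "(\<lambda>x :: 'r alg_closure ^ 'n ^ 'n. inverse (det x)) \<in> GL_ring"
    unfolding GL_ring_def by (rule algebra_generated.gen) simp
  ultimately have "(\<lambda>x :: 'r alg_closure ^ 'n ^ 'n.
      det (\<chi> i l. if l = k then axis j 1 $ i else x $ i $ l) * inverse (det x)) \<in> GL_ring"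
    unfolding GL_ring_def by (rule algebra_generated.mult)
  then show ?thesis
    by (rule rev_bexI) (simp add: matrix_inv_entry_cramer)
qed

lemma GL_ring_real_value:
  assumes "F \<in> GL_ring"
  shows "\<exists>c. F (map_matrix to_ac h) = to_ac c"
  using assms unfolding GL_ring_def
proof induction
  case (gen F)
  then show ?case
    by (auto simp: det_map_matrix_to_ac simp flip: to_ac_inverse)
next
  case (const c)
  show ?case
    by blast
next
  case (add F H)
  then obtain c d where "F (map_matrix to_ac h) = to_ac c" "H (map_matrix to_ac h) = to_ac d"
    by blast
  then show ?case
    by (simp flip: to_ac_add)
next
  case (mult F H)
  then obtain c d where "F (map_matrix to_ac h) = to_ac c" "H (map_matrix to_ac h) = to_ac d"
    by blast
  then show ?case
    by (simp flip: to_ac_mult)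
qed

text \<open>The group \<open>G(R)\<close> as matrices over the ordered field \<open>R\<close> itself, where inequalities make
  sense.\<close>

definition real_points :: "('r::field alg_closure ^ 'n ^ 'n) set \<Rightarrow> ('r ^ 'n ^ 'n) set" where
  "real_points G = {h. map_matrix to_ac h \<in> G}"

lemma rational_points_eq: "rational_points G = map_matrix to_ac ` real_points G"
proof -
  have "x \<in> map_matrix to_ac ` real_points G" if x: "x \<in> rational_points G" for x
  proof
    show "x = map_matrix to_ac (\<chi> i j. of_ac (x $ i $ j))"
      using x by (simp add: vec_eq_iff rational_points_def to_ac_of_ac)
    then show "(\<chi> i j. of_ac (x $ i $ j)) \<in> real_points G"
      using x by (simp add: real_points_def rational_points_def)
  qed
  then show ?thesis
    by (auto simp: rational_points_def real_points_def)
qed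

lemma coord_ring_eq_on_real_points:
  assumes dense: "zariski_dense_in (rational_points G) G"
    and F: "F \<in> coord_ring G" and H: "H \<in> coord_ring G"
    and eq: "\<And>h. h \<in> real_points G \<Longrightarrow> F (map_matrix to_ac h) = H (map_matrix to_ac h)"
  shows "F = H"
proof
  fix x
  obtain F' H' where F': "F' \<in> GL_ring" "F = restrict0 G F'" and H': "H' \<in> GL_ring" "H = restrict0 G H'"
    using F H unfolding coord_ring_def by blast
  have "(\<lambda>x. F' x + to_ac (- 1) * H' x) \<in> GL_ring"
    using F' H' unfolding GL_ring_def
    by (intro algebra_generated.add algebra_generated.mult algebra_generated.const)
  moreover have "(\<lambda>x. F x - H x) = restrict0 G (\<lambda>x. F' x + to_ac (- 1) * H' x)"
    by (auto simp: F' H' restrict0_def)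
  ultimately have diff_mem: "(\<lambda>x. F x - H x) \<in> coord_ring G"
    unfolding coord_ring_def by blast
  have "F x - H x = 0" if "x \<in> rational_points G" for x
    using eq that by (auto simp: rational_points_eq)
  then have "F x - H x = 0" if "x \<in> G" for x
    using dense[unfolded zariski_dense_in_def, THEN conjunct2, rule_format, OF diff_mem _ that]
    by simp
  then show "F x = H x"
    by (cases "x \<in> G") (auto simp: F' H' restrict0_def)
qed

lemma coord_ring_const: "restrict0 G (\<lambda>_. to_ac c) \<in> coord_ring G"
  unfolding coord_ring_def GL_ring_def by (intro imageI algebra_generated.const)

lemma coord_ring_add:
  assumes "F \<in> coord_ring G" and "H \<in> coord_ring G"
  shows "(\<lambda>x. F x + H x) \<in> coord_ring G"
proof -
  obtain F' H' where F': "F' \<in> GL_ring" "F = restrict0 G F'" and H': "H' \<in> GL_ring" "H = restrict0 G H'"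
    using assms unfolding coord_ring_def by blast
  then have "(\<lambda>x. F' x + H' x) \<in> GL_ring"
    unfolding GL_ring_def by (intro algebra_generated.add)
  moreover have "(\<lambda>x. F x + H x) = restrict0 G (\<lambda>x. F' x + H' x)"
    by (auto simp: F' H' restrict0_def)
  ultimately show ?thesis
    unfolding coord_ring_def by blast
qed

lemma coord_ring_mult:
  assumes "F \<in> coord_ring G" and "H \<in> coord_ring G"
  shows "(\<lambda>x. F x * H x) \<in> coord_ring G"
proof -
  obtain F' H' where F': "F' \<in> GL_ring" "F = restrict0 G F'" and H': "H' \<in> GL_ring" "H = restrict0 G H'"
    using assms unfolding coord_ring_def by blast
  then have "(\<lambda>x. F' x * H' x) \<in> GL_ring"
    unfolding GL_ring_def by (intro algebra_generated.mult)
  moreover have "(\<lambda>x. F x * H x) = restrict0 G (\<lambda>x. F' x * H' x)"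
    by (auto simp: F' H' restrict0_def)
  ultimately show ?thesis
    unfolding coord_ring_def by blast
qed

section \<open>The Reynolds operator as a positive invariant mean\<close>

text \<open>Translating \<open>1\<close> by a real point shows \<open>F g = F 1\<close> for all real points \<open>g\<close>; density extends this to
  \<open>G\<close>. The value at the real point \<open>1\<close> lies in \<open>R\<close>.\<close>

lemma invariant_function_constant:
  assumes one: "mat 1 \<in> G" and dense: "zariski_dense_in (rational_points G) G"
    and F: "F \<in> invariant_ring (rational_points G) (\<lambda>g x. g ** x) (coord_ring G)"
  shows "\<exists>c. F = restrict0 G (\<lambda>_. to_ac c)"
proof -
  have F_ring: "F \<in> coord_ring G" and F_inv: "\<And>g x. g \<in> rational_points G \<Longrightarrow> F (g ** x) = F x"
    using F unfolding invariant_ring_def by (auto dest: fun_cong)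
  obtain F' where F': "F' \<in> GL_ring" "F = restrict0 G F'"
    using F_ring unfolding coord_ring_def by blast
  have "mat 1 = map_matrix to_ac (mat 1)"
    by (simp add: vec_eq_iff mat_def)
  then obtain c where c: "F' (mat 1) = to_ac c"
    using GL_ring_real_value[OF F'(1)] by metis
  have "F = restrict0 G (\<lambda>_. to_ac c)"
  proof (rule coord_ring_eq_on_real_points[OF dense F_ring coord_ring_const])
    fix h assume "h \<in> real_points G"
    then have h: "map_matrix to_ac h \<in> G" "map_matrix to_ac h \<in> rational_points G"
      by (auto simp: rational_points_eq real_points_def)
    have "F (map_matrix to_ac h) = F (mat 1)"
      using F_inv[OF h(2), of "mat 1"] by simp
    then show "F (map_matrix to_ac h) = restrict0 G (\<lambda>_. to_ac c) (map_matrix to_ac h)"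
      using h(1) one by (simp add: F' c restrict0_def)
  qed
  then show ?thesis ..
qed

text \<open>The mean of \<open>F\<close> is the unique \<open>c\<close> for which \<open>F - c\<close> lies in the stable complement \<open>W\<close>: it exists because
  \<open>\<rho> F\<close> is a constant, and it is unique because \<open>W\<close> contains no nonzero constants. In this
  description linearity and invariance are the closure properties of \<open>W\<close>, although \<open>\<rho>\<close> is only known to be
  a function. The passage from \<open>F\<close> to its restriction \<open>f\<close> to the real points loses nothing by density.\<close>

lemma property_star_positive_invariant_mean:
  fixes G :: "('r::real_closed_field alg_closure ^ 'n ^ 'n) set"
  assumes group: "linear_algebraic_group G"
    and dense: "zariski_dense_in (rational_points G) G"
    and star: "property_star G"
  shows "\<exists>A L. positive_invariant_mean (real_points G) A L"
proof -
  let ?R = "coord_ring G" and ?inv = "invariant_ring (rational_points G) (\<lambda>g x. g ** x) (coord_ring G)"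
  let ?const = "\<lambda>c. restrict0 G (\<lambda>_. to_ac c)" and ?m = "map_matrix to_ac :: 'r ^ 'n ^ 'n \<Rightarrow> _"
  have one: "mat 1 \<in> G" and G_mult: "\<And>x y. x \<in> G \<Longrightarrow> y \<in> G \<Longrightarrow> x ** y \<in> G"
    and G_inv: "\<And>x. x \<in> G \<Longrightarrow> invertible x \<and> matrix_inv x \<in> G"
    using group unfolding linear_algebraic_group_def zariski_closed_def by auto
  have translate_mem: "g ** x \<in> G \<longleftrightarrow> x \<in> G" if "g \<in> G" for g x
  proof
    assume "g ** x \<in> G"
    then have "matrix_inv g ** (g ** x) \<in> G"
      using G_mult G_inv[OF that] by blast
    then show "x \<in> G"
      using matrix_inv_inverse[of g] G_inv[OF that] by (simp add: matrix_mul_assoc)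
  qed (use G_mult that in blast)
  obtain \<rho> where \<rho>: "is_reynolds_operator (rational_points G) (\<lambda>g x. g ** x) ?R \<rho>"
    and \<rho>_square: "\<And>F. F \<in> ?R \<Longrightarrow> \<exists>c\<ge>0. \<rho> (\<lambda>x. F x * F x) = ?const c"
    using star unfolding property_star_def by blast
  obtain W where W_sub: "W \<subseteq> ?R" and W: "stable_subspace (rational_points G) (\<lambda>g x. g ** x) W"
    and W_inv: "W \<inter> ?inv = {\<lambda>_. 0}" and \<rho>_inv: "\<And>F. F \<in> ?R \<Longrightarrow> \<rho> F \<in> ?inv"
    and \<rho>_W: "\<And>F. F \<in> ?R \<Longrightarrow> (\<lambda>x. F x - \<rho> F x) \<in> W"
    using \<rho> unfolding is_reynolds_operator_def by blast
  have W_zero: "(\<lambda>_. 0) \<in> W"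
    and W_add: "\<And>F H. F \<in> W \<Longrightarrow> H \<in> W \<Longrightarrow> (\<lambda>x. F x + H x) \<in> W"
    and W_scale: "\<And>c F. F \<in> W \<Longrightarrow> (\<lambda>x. to_ac c * F x) \<in> W"
    and W_translate: "\<And>g F. g \<in> rational_points G \<Longrightarrow> F \<in> W \<Longrightarrow> (\<lambda>x. F (g ** x)) \<in> W"
    using W unfolding stable_subspace_def by blast+
  define rep where "rep F f \<longleftrightarrow> F \<in> ?R \<and> (\<forall>h\<in>real_points G. F (?m h) = to_ac (f h))"
    for F and f :: "'r ^ 'n ^ 'n \<Rightarrow> 'r"
  define val where "val f c \<longleftrightarrow> (\<exists>F. rep F f \<and> (\<lambda>x. F x - ?const c x) \<in> W)" for f c
  define A where "A = {f. \<exists>F. rep F f}"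
  define L where "L f = (THE c. val f c)" for f
  have rep_unique: "F = H" if "rep F f" "rep H f" for F H f
    using coord_ring_eq_on_real_points[OF dense, of F H] that unfolding rep_def by simp
  have const_mem_W: "c = 0" if "?const c \<in> W" for c
  proof -
    have "(\<lambda>x. ?const c (g ** x)) = ?const c" if "g \<in> rational_points G" for g
      using translate_mem[of g] that by (auto simp: restrict0_def rational_points_def)
    then have "?const c \<in> ?inv"
      unfolding invariant_ring_def using coord_ring_const by auto
    then have "?const c = (\<lambda>_. 0)"
      using W_inv that by blast
    then have "?const c (mat 1) = 0"
      by (rule fun_cong)
    then show ?thesis
      using one by (simp add: restrict0_def)
  qed
  have val_unique: "c = d" if c: "val f c" and d: "val f d" for f c d
  proof -
    obtain F where F: "rep F f" "(\<lambda>x. F x - ?const c x) \<in> W"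
      using c unfolding val_def by blast
    obtain H where H: "rep H f" "(\<lambda>x. H x - ?const d x) \<in> W"
      using d unfolding val_def by blast
    have "H = F"
      using H(1) F(1) by (rule rep_unique)
    have "(\<lambda>x. (F x - ?const c x) + to_ac (- 1) * (F x - ?const d x)) \<in> W"
      using F(2) H(2) unfolding \<open>H = F\<close> by (intro W_add W_scale)
    also have "(\<lambda>x. (F x - ?const c x) + to_ac (- 1) * (F x - ?const d x)) = ?const (d - c)"
      by (auto simp: restrict0_def)
    finally show ?thesis
      using const_mem_W[of "d - c"] by simp
  qed
  have valI: "val f c" if "rep F f" "(\<lambda>x. F x - ?const c x) \<in> W" for F f c
    using that unfolding val_def by blast
  have L_eq: "L f = c" if "val f c" for f c
    unfolding L_def using that val_unique[OF _ that] by (rule the_equality)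
  have val_L: "val f (L f)" if f: "f \<in> A" for f
  proof -
    obtain F where F: "rep F f"
      using f unfolding A_def by blast
    then have "F \<in> ?R"
      unfolding rep_def by blast
    obtain c where "\<rho> F = ?const c"
      using invariant_function_constant[OF one dense \<rho>_inv[OF \<open>F \<in> ?R\<close>]] by blast
    then have "val f c"
      using \<rho>_W[OF \<open>F \<in> ?R\<close>] by (intro valI[OF F]) simp
    then show ?thesis
      by (simp add: L_eq)
  qed
  have rep_add: "rep (\<lambda>x. F x + H x) (\<lambda>x. f x + h x)" if "rep F f" "rep H h" for F H f h
    using that unfolding rep_def by (simp add: coord_ring_add)
  have rep_mult: "rep (\<lambda>x. F x * H x) (\<lambda>x. f x * h x)" if "rep F f" "rep H h" for F H f h
    using that unfolding rep_def by (simp add: coord_ring_mult)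
  have rep_const: "rep (?const c) (\<lambda>_. c)" for c
    unfolding rep_def
  proof
    show "\<forall>h\<in>real_points G. ?const c (?m h) = to_ac c"
      by (simp add: real_points_def restrict0_def)
  qed (rule coord_ring_const)
  have rep_restrict: "rep (restrict0 G F) f"
    if "F \<in> GL_ring" and "\<And>h. h \<in> real_points G \<Longrightarrow> F (?m h) = to_ac (f h)" for F f
    unfolding rep_def
  proof
    show "restrict0 G F \<in> ?R"
      unfolding coord_ring_def using that(1) by (rule imageI)
    show "\<forall>h\<in>real_points G. restrict0 G F (?m h) = to_ac (f h)"
      using that(2) by (simp add: real_points_def restrict0_def)
  qed
  have "positive_invariant_mean (real_points G) A L"
  proof
    show "x ** y \<in> real_points G" if "x \<in> real_points G" "y \<in> real_points G" for x y
      using that G_mult by (simp add: real_points_def map_matrix_to_ac_mult)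
    show inverse: "invertible x \<and> matrix_inv x \<in> real_points G" if "x \<in> real_points G" for x
    proof -
      have "invertible x"
        using that G_inv[of "?m x"] by (simp add: real_points_def invertible_map_matrix_to_ac)
      then show ?thesis
        using that G_inv[of "?m x"] by (simp add: real_points_def map_matrix_to_ac_inv)
    qed
    show "(\<lambda>_. c) \<in> A" for c
      unfolding A_def using rep_const by blast
    show "(\<lambda>x. x $ i $ j) \<in> A" for i j
      unfolding A_def using rep_restrict[OF GL_ring_entry] by fastforce
    show "(\<lambda>x. matrix_inv x $ i $ j) \<in> A" for i j
    proof -
      obtain F :: "'r alg_closure ^ 'n ^ 'n \<Rightarrow> 'r alg_closure"
        where F: "F \<in> GL_ring" "\<And>x. invertible x \<Longrightarrow> F x = matrix_inv x $ i $ j"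
        using GL_ring_inverse_entry by blast
      have "F (?m h) = to_ac (matrix_inv h $ i $ j)" if "h \<in> real_points G" for h
        using inverse[OF that] F(2)[of "?m h"]
        by (simp add: invertible_map_matrix_to_ac flip: map_matrix_to_ac_inv)
      then have "rep (restrict0 G F) (\<lambda>x. matrix_inv x $ i $ j)"
        using F(1) by (intro rep_restrict)
      then show ?thesis
        unfolding A_def by blast
    qed
    show "(\<lambda>x. f x + h x) \<in> A" "(\<lambda>x. f x * h x) \<in> A" if "f \<in> A" "h \<in> A" for f h
      using that rep_add rep_mult unfolding A_def by blast+
    show "L f = L h" if "f \<in> A" "h \<in> A" "\<And>x. x \<in> real_points G \<Longrightarrow> f x = h x" for f h
    proof -
      have "val h = val f"
        unfolding val_def rep_def using that(3) by auto
      then show ?thesis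
        by (simp add: L_def)
    qed
    show "L (\<lambda>x. f x + h x) = L f + L h" if f: "f \<in> A" and h: "h \<in> A" for f h
    proof (rule L_eq)
      obtain F H where F: "rep F f" "(\<lambda>x. F x - ?const (L f) x) \<in> W"
        and H: "rep H h" "(\<lambda>x. H x - ?const (L h) x) \<in> W"
        using val_L[OF f] val_L[OF h] unfolding val_def by blast
      have "(\<lambda>x. (F x - ?const (L f) x) + (H x - ?const (L h) x)) \<in> W"
        using F(2) H(2) by (rule W_add)
      also have "(\<lambda>x. (F x - ?const (L f) x) + (H x - ?const (L h) x)) =
          (\<lambda>x. F x + H x - ?const (L f + L h) x)"
        by (auto simp: restrict0_def)
      finally show "val (\<lambda>x. f x + h x) (L f + L h)"
        by (rule valI[OF rep_add[OF F(1) H(1)]])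
    qed
    show "L (\<lambda>x. c * f x) = c * L f" if f: "f \<in> A" for f c
    proof (rule L_eq)
      obtain F where F: "rep F f" "(\<lambda>x. F x - ?const (L f) x) \<in> W"
        using val_L[OF f] unfolding val_def by blast
      have F_outside: "F x = 0" if "x \<notin> G" for x
        using F(1) that unfolding rep_def coord_ring_def by (auto simp: restrict0_def)
      have "(\<lambda>x. to_ac c * (F x - ?const (L f) x)) \<in> W"
        using F(2) by (rule W_scale)
      also have "(\<lambda>x. to_ac c * (F x - ?const (L f) x)) =
          (\<lambda>x. ?const c x * F x - ?const (c * L f) x)"
        by (auto simp: restrict0_def F_outside algebra_simps)
      finally show "val (\<lambda>x. c * f x) (c * L f)"
        by (rule valI[OF rep_mult[OF rep_const F(1)]])
    qed
    show "L (\<lambda>_. 1) = 1"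
    proof (rule L_eq)
      have "(\<lambda>x. ?const 1 x - ?const 1 x) \<in> W"
        using W_zero by simp
      then show "val (\<lambda>_. 1) 1"
        by (rule valI[OF rep_const])
    qed
    show "L (\<lambda>x. f (g ** x)) = L f" if g: "g \<in> real_points G" and f: "f \<in> A" for g f
    proof (rule L_eq)
      obtain F where F: "rep F f" "(\<lambda>x. F x - ?const (L f) x) \<in> W"
        using val_L[OF f] unfolding val_def by blast
      have gG: "?m g \<in> G" "?m g \<in> rational_points G"
        using g by (auto simp: rational_points_eq real_points_def)
      have "(\<lambda>x. F (?m g ** x) - ?const (L f) (?m g ** x)) \<in> W"
        using W_translate[OF gG(2) F(2)] .
      then have W_mem: "(\<lambda>x. F (?m g ** x) - ?const (L f) x) \<in> W"
        using translate_mem[OF gG(1)] by (simp add: restrict0_def)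
      then have "(\<lambda>x. (F (?m g ** x) - ?const (L f) x) + ?const (L f) x) \<in> ?R"
        using W_sub by (intro coord_ring_add coord_ring_const) blast
      then have "(\<lambda>x. F (?m g ** x)) \<in> ?R"
        by simp
      moreover have "F (?m g ** ?m h) = to_ac (f (g ** h))" if "h \<in> real_points G" for h
      proof -
        have "g ** h \<in> real_points G"
          using g that G_mult by (simp add: real_points_def map_matrix_to_ac_mult)
        then show ?thesis
          using F(1) unfolding rep_def by (simp flip: map_matrix_to_ac_mult)
      qed
      ultimately have "rep (\<lambda>x. F (?m g ** x)) (\<lambda>x. f (g ** x))"
        unfolding rep_def by simp
      then show "val (\<lambda>x. f (g ** x)) (L f)"
        using W_mem by (rule valI)
    qed
    show "0 \<le> L (\<lambda>x. f x * f x)" if f: "f \<in> A" for f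
    proof -
      obtain F where F: "rep F f" "F \<in> ?R"
        using f unfolding A_def rep_def by blast
      obtain c where "0 \<le> c" and c: "\<rho> (\<lambda>x. F x * F x) = ?const c"
        using \<rho>_square[OF F(2)] by blast
      have "val (\<lambda>x. f x * f x) c"
        using \<rho>_W[OF coord_ring_mult[OF F(2) F(2)]] by (intro valI[OF rep_mult[OF F(1) F(1)]]) (simp add: c)
      then show ?thesis
        using L_eq \<open>0 \<le> c\<close> by simp
    qed
  qed
  then show ?thesis
    by blast
qed

section \<open>Closedness and the compactness theorem\<close>

text \<open>The function \<open>\<phi>\<close> is a polynomial with coefficients in \<open>R\<close> that expresses \<open>F\<close> in the generators. It is
  built along the derivation of \<open>F\<close>, as that is where continuity can be read off.\<close>

lemma algebra_generated_continuous_coordinates: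
  fixes f :: "nat \<Rightarrow> 'x \<Rightarrow> 'r::real_closed_field alg_closure"
  assumes "F \<in> algebra_generated (f ` {..<N})"
  shows "\<exists>\<phi>. continuous_map (product_topology (\<lambda>_. interval_topology) {..<N}) interval_topology \<phi> \<and>
    (\<forall>p x. (\<forall>i<N. to_ac (p i) = f i x) \<longrightarrow> to_ac (\<phi> p) = F x)"
  using assms
proof induction
  case (const c)
  show ?case
    by (rule exI[of _ "\<lambda>_. c"]) (simp only: continuous_map_interval_const simp_thms)
next
  case (gen F)
  then obtain i where "i < N" "F = f i"
    by auto
  then show ?case
    by (intro exI[of _ "\<lambda>p. p i"]) (auto intro: continuous_map_product_projection)
next
  case (add F H)
  then obtain \<phi> \<psi>
    where cont: "continuous_map (product_topology (\<lambda>_. interval_topology) {..<N}) interval_topology \<phi>"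
      "continuous_map (product_topology (\<lambda>_. interval_topology) {..<N}) interval_topology \<psi>"
      and eval: "\<And>p x. (\<forall>i<N. to_ac (p i) = f i x) \<Longrightarrow> to_ac (\<phi> p) = F x"
      "\<And>p x. (\<forall>i<N. to_ac (p i) = f i x) \<Longrightarrow> to_ac (\<psi> p) = H x"
    by blast
  have "to_ac (\<phi> p + \<psi> p) = F x + H x" if "\<forall>i<N. to_ac (p i) = f i x" for p x
    using eval[OF that] by simp
  then show ?case
    using continuous_map_interval_add[OF cont] by blast
next
  case (mult F H)
  then obtain \<phi> \<psi>
    where cont: "continuous_map (product_topology (\<lambda>_. interval_topology) {..<N}) interval_topology \<phi>"
      "continuous_map (product_topology (\<lambda>_. interval_topology) {..<N}) interval_topology \<psi>"
      and eval: "\<And>p x. (\<forall>i<N. to_ac (p i) = f i x) \<Longrightarrow> to_ac (\<phi> p) = F x"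
      "\<And>p x. (\<forall>i<N. to_ac (p i) = f i x) \<Longrightarrow> to_ac (\<psi> p) = H x"
    by blast
  have "to_ac (\<phi> p * \<psi> p) = F x * H x" if "\<forall>i<N. to_ac (p i) = f i x" for p x
    using eval[OF that] by simp
  then show ?case
    using continuous_map_interval_mult[OF cont] by blast
qed

text \<open>The image of \<open>G(R)\<close> in affine space is cut out by the equation saying that the coordinate \<open>d\<close> of
  \<open>1/det\<close> is inverse to the determinant of the matrix of the other coordinates, and by the equations of
  \<open>G\<close>. All of them are continuous, so their zero sets are closed. That \<open>f\<close> enumerates the generators without
  repetition ensures that these coordinates determine all others.\<close>

lemma real_points_closed:
  fixes G :: "('r::real_closed_field alg_closure ^ 'n ^ 'n) set"
    and f :: "nat \<Rightarrow> 'r alg_closure ^ 'n ^ 'n \<Rightarrow> 'r alg_closure"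
  assumes closed: "zariski_closed G"
    and f: "bij_betw f {..<N} (insert (\<lambda>A. inverse (det A)) (range (\<lambda>(i, j) A. A $ i $ j)))"
  shows "closedin (product_topology (\<lambda>_. interval_topology) {..<N})
    {p \<in> {..<N} \<rightarrow>\<^sub>E UNIV. \<exists>x\<in>rational_points G. \<forall>i<N. to_ac (p i) = f i x}"
    (is "closedin ?T ?S")
proof -
  have f_image: "f ` {..<N} = insert (\<lambda>A. inverse (det A)) (range (\<lambda>(i, j) A. A $ i $ j))"
    using f by (rule bij_betw_imp_surj_on)
  have index_of: "\<exists>m. m < N \<and> f m = F" if "F \<in> f ` {..<N}" for F
    using that by auto
  have "\<exists>m. m < N \<and> f m = (\<lambda>A. A $ i $ j)" for i j
    by (rule index_of) (auto simp: f_image intro: rev_image_eqI[of "(i, j)"])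
  then have "\<exists>k. \<forall>i j. k i j < N \<and> f (k i j) = (\<lambda>A. A $ i $ j)"
    by (intro choice allI)
  then obtain k where k: "\<And>i j. k i j < N" "\<And>i j. f (k i j) = (\<lambda>A. A $ i $ j)"
    by blast
  obtain d where d: "d < N" "f d = (\<lambda>A. inverse (det A))"
    using index_of[of "\<lambda>A. inverse (det A)"] f_image by blast
  have index: "m = d \<or> (\<exists>i j. m = k i j)" if "m < N" for m
  proof -
    have "f m \<in> f ` {..<N}"
      using that by simp
    then have "f m = f d \<or> (\<exists>i j. f m = f (k i j))"
      unfolding f_image by (auto simp: k(2) d(2))
    then show ?thesis
      using bij_betw_imp_inj_on[OF f] that k(1) d(1) by (auto simp: inj_on_def)
  qed
  obtain \<F> where \<F>: "\<F> \<subseteq> GL_ring" and G: "G = {A. invertible A \<and> (\<forall>F\<in>\<F>. F A = 0)}"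
    using closed unfolding zariski_closed_def by blast
  have "\<exists>\<phi>. continuous_map ?T interval_topology \<phi> \<and>
      (\<forall>p x. (\<forall>i<N. to_ac (p i) = f i x) \<longrightarrow> to_ac (\<phi> p) = F x)" if "F \<in> \<F>" for F
    using algebra_generated_continuous_coordinates[of F f N] that \<F> f_image
    by (auto simp: GL_ring_def)
  then have "\<exists>\<phi>. \<forall>F\<in>\<F>. continuous_map ?T interval_topology (\<phi> F) \<and>
      (\<forall>p x. (\<forall>i<N. to_ac (p i) = f i x) \<longrightarrow> to_ac (\<phi> F p) = F x)"
    by (intro bchoice ballI)
  then obtain \<phi> where \<phi>_cont: "\<And>F. F \<in> \<F> \<Longrightarrow> continuous_map ?T interval_topology (\<phi> F)"
    and \<phi>: "\<And>F p x. F \<in> \<F> \<Longrightarrow> \<forall>i<N. to_ac (p i) = f i x \<Longrightarrow> to_ac (\<phi> F p) = F x"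
    by blast
  define M where "M p = (\<chi> i j. p (k i j))" for p :: "nat \<Rightarrow> 'r"
  define \<delta> where "\<delta> p = p d * det (M p) + - 1" for p :: "nat \<Rightarrow> 'r"
  have projection: "continuous_map ?T interval_topology (\<lambda>p. p i)" if "i < N" for i
    using that by (intro continuous_map_product_projection) simp
  have "continuous_map ?T interval_topology \<delta>"
    unfolding \<delta>_def M_def
    by (intro continuous_map_interval_add continuous_map_interval_mult continuous_map_interval_det
        continuous_map_interval_const) (simp_all add: projection d k)
  then have closed_equations: "closedin ?T {p \<in> topspace ?T. \<psi> p = 0}" if "\<psi> \<in> insert \<delta> (\<phi> ` \<F>)" for \<psi>
    using that \<phi>_cont closedin_zero_set by blast
  have topspace: "topspace ?T = {..<N} \<rightarrow>\<^sub>E UNIV"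
    by simp
  have "?S = (\<Inter>\<psi>\<in>insert \<delta> (\<phi> ` \<F>). {p \<in> topspace ?T. \<psi> p = 0})"
  proof (intro equalityI subsetI)
    fix p
    assume "p \<in> ?S"
    then obtain x where p: "p \<in> {..<N} \<rightarrow>\<^sub>E UNIV" and x: "x \<in> G" and px: "\<forall>i<N. to_ac (p i) = f i x"
      unfolding rational_points_def by blast
    have "\<phi> F p = 0" if "F \<in> \<F>" for F
    proof -
      have "F x = 0"
        using x that unfolding G by blast
      then have "to_ac (\<phi> F p) = 0"
        using \<phi>[OF that px] by simp
      then show ?thesis
        by simp
    qed
    moreover have "\<delta> p = 0"
    proof -
      have "map_matrix to_ac (M p) = x"
        using px k by (simp add: vec_eq_iff M_def)
      moreover have "to_ac (p d) * det x = 1"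
        using px d x unfolding G by (simp add: invertible_det_nz)
      ultimately have "to_ac (p d * det (M p)) = to_ac 1"
        by (auto simp flip: det_map_matrix_to_ac)
      then show ?thesis
        unfolding \<delta>_def by (simp only: to_ac_eq_iff)
    qed
    ultimately show "p \<in> (\<Inter>\<psi>\<in>insert \<delta> (\<phi> ` \<F>). {p \<in> topspace ?T. \<psi> p = 0})"
      using p topspace by auto
  next
    fix p
    assume "p \<in> (\<Inter>\<psi>\<in>insert \<delta> (\<phi> ` \<F>). {p \<in> topspace ?T. \<psi> p = 0})"
    then have p: "p \<in> {..<N} \<rightarrow>\<^sub>E UNIV" and "\<delta> p = 0" and \<phi>_zero: "\<And>F. F \<in> \<F> \<Longrightarrow> \<phi> F p = 0"
      using topspace by auto
    let ?x = "map_matrix to_ac (M p)"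
    have "p d * det (M p) = 1"
      using \<open>\<delta> p = 0\<close> by (simp add: \<delta>_def)
    then have "det (M p) \<noteq> 0" "p d = inverse (det (M p))"
      by (auto simp: inverse_unique mult.commute)
    have px: "\<forall>i<N. to_ac (p i) = f i ?x"
    proof (intro allI impI)
      fix m
      assume "m < N"
      then show "to_ac (p m) = f m ?x"
        using index[of m] \<open>p d = inverse (det (M p))\<close> k(2) d(2)
        by (auto simp: det_map_matrix_to_ac M_def)
    qed
    have "invertible ?x"
      using \<open>det (M p) \<noteq> 0\<close> by (simp add: invertible_det_nz det_map_matrix_to_ac)
    moreover have "F ?x = 0" if "F \<in> \<F>" for F
      using \<phi>[OF that px] \<phi>_zero[OF that] by simp
    ultimately have "?x \<in> rational_points G"
      unfolding rational_points_def using G by auto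
    then show "p \<in> ?S"
      using p px by blast
  qed
  then show ?thesis
    using closed_equations by (simp only:) (intro closedin_INT, auto)
qed

theorem theorem4p5:
  fixes G :: "('r::real_closed_field alg_closure ^ 'n ^ 'n) set"
  assumes "linear_algebraic_group G"
    and "zariski_dense_in (rational_points G) G"
    and "reductive G"
    and "property_star G"
  shows "points_semialgebraically_compact G"
proof -
  let ?gens = "insert (\<lambda>A. inverse (det A)) (range (\<lambda>(i, j) A. A $ i $ j))
    :: ('r alg_closure ^ 'n ^ 'n \<Rightarrow> 'r alg_closure) set"
  obtain f where f: "bij_betw f {..<card ?gens} ?gens"
    using ex_bij_betw_nat_finite[of ?gens] by (auto simp: atLeast0LessThan)
  then have f_image: "f ` {..<card ?gens} = ?gens"
    by (rule bij_betw_imp_surj_on)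
  obtain A L where "positive_invariant_mean (real_points G) A L"
    using property_star_positive_invariant_mean assms by blast
  then interpret positive_invariant_mean "real_points G" A L .
  obtain B C where B: "\<And>g i k. g \<in> real_points G \<Longrightarrow> \<bar>g $ i $ k\<bar> \<le> B"
    and C: "\<And>g. g \<in> real_points G \<Longrightarrow> \<bar>inverse (det g)\<bar> \<le> C"
    using entries_bounded inverse_det_bounded by blast
  have bounded: "\<bar>p m\<bar> \<le> max B C"
    if g: "g \<in> real_points G" and m: "m < card ?gens" and p: "to_ac (p m) = f m (map_matrix to_ac g)"
    for p :: "nat \<Rightarrow> 'r" and g m
  proof -
    have "f m \<in> ?gens"
      using f_image m by blast
    then consider "f m = (\<lambda>A. inverse (det A))" | i k where "f m = (\<lambda>A. A $ i $ k)"
      by auto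
    then show ?thesis
    proof cases
      case 1
      then have "p m = inverse (det g)"
        using p by (simp add: det_map_matrix_to_ac flip: to_ac_inverse)
      then show ?thesis
        using C[OF g] by (simp add: le_max_iff_disj)
    next
      case 2
      then have "p m = g $ i $ k"
        using p by simp
      then show ?thesis
        using B[OF g, of i k] by (simp add: le_max_iff_disj)
    qed
  qed
  have "semialgebraically_closed_bounded (card ?gens)
      {p \<in> {..<card ?gens} \<rightarrow>\<^sub>E UNIV. \<exists>x\<in>rational_points G. \<forall>i<card ?gens. to_ac (p i) = f i x}"
    unfolding semialgebraically_closed_bounded_def
  proof
    show "closedin (product_topology (\<lambda>_. interval_topology) {..<card ?gens})
        {p \<in> {..<card ?gens} \<rightarrow>\<^sub>E UNIV. \<exists>x\<in>rational_points G. \<forall>i<card ?gens. to_ac (p i) = f i x}"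
      using real_points_closed f assms(1) unfolding linear_algebraic_group_def by blast
  qed (use bounded in \<open>auto simp: rational_points_eq intro!: exI[of _ "max B C"]\<close>)
  moreover have "coord_ring G = restrict0 G ` algebra_generated (f ` {..<card ?gens})"
    unfolding coord_ring_def GL_ring_def f_image ..
  ultimately show ?thesis
    unfolding points_semialgebraically_compact_def by blast
qed

end
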